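(* Let $\mathbf{k}$ be a field, $n\in\mathbb{N}$, and $\lambda_1,\lambda_2,\ldots,\lambda_n\in\mathbf{k}$. Then $$\operatorname{Spec}\left(R(\lambda_1t_1+\lambda_2t_2+\cdots+\lambda_nt_n)\right)=\left\{\lambda_1m_{I,1}+\lambda_2m_{I,2}+\cdots+\lambda_nm_{I,n}\mid I\subseteq[n-1]\text{ is lacunar}\right\},$$ where $\operatorname{Spec}g$ denotes the set of all eigenvalues (in $\mathbf{k}$) of a $\mathbf{k}$-linear operator $g$.
   Context: $\mathbb{N}=\{0,1,2,\ldots\}$; $[m]=\{1,\ldots,m\}$ (empty if $m\le 0$). $S_n$ is the group of permutations of $[n]$, with product $(\pi\sigma)(i)=\pi(\sigma(i))$; $\mathbf{k}[S_n]$ is its group algebra. For distinct $i_1,\ldots,i_k\in[n]$, $\operatorname{cyc}_{i_1,\ldots,i_k}\in S_n$ sends $i_1,\ldots,i_{k-1},i_k$ to $i_2,\ldots,i_k,i_1$, respectively, and fixes all other elements. For $\ell\in[n]$, $t_\ell:=\operatorname{cyc}_\ell+\operatorname{cyc}_{\ell,\ell+1}+\cdots+\operatorname{cyc}_{\ell,\ell+1,\ldots,n}\in\mathbf{k}[S_n]$. For $x\in\mathbf{k}[S_n]$, $R(x):\mathbf{k}[S_n]\to\mathbf{k}[S_n]$ is the $\mathbf{k}$-linear map $y\mapsto yx$. A set of integers is lacunar if it contains no two consecutive integers. For $I\subseteq[n]$ and $\ell\in[n]$, let $\widehat I:=\{0\}\cup I\cup\{n+1\}$ and $m_{I,\ell}:=(\text{smallest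 element of }\widehat I\text{ that is}\ge\ell)-\ell$ (an integer, viewed in $\mathbf{k}$ where appropriate). *)

theory Defs
  imports Complex_Main "HOL-Algebra.Sym_Groups" "HOL-Combinatorics.Cycles" "HOL-Library.Poly_Mapping"
begin

section \<open>Group algebras\<close>

text \<open>
  The elements of the group algebra of \<open>G\<close> over \<open>'k\<close> are the finitely supported functions
  on the underlying type whose support lies in \<open>carrier G\<close>. The standard basis vector
  belonging to \<open>g\<close> is \<open>Poly_Mapping.single g 1\<close>. The multiplication of type \<open>poly_mapping\<close>
  itself (convolution along \<open>+\<close> on the keys) plays no role here; \<open>ga_mult\<close> is the bilinear
  extension of the multiplication of \<open>G\<close>.
\<close>

definition group_algebra :: "('g, 'x) monoid_scheme \<Rightarrow> ('g \<Rightarrow>\<^sub>0 'k::field) set"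
  where "group_algebra G = {a. Poly_Mapping.keys a \<subseteq> carrier G}"

definition ga_scale :: "'k::field \<Rightarrow> ('g \<Rightarrow>\<^sub>0 'k) \<Rightarrow> ('g \<Rightarrow>\<^sub>0 'k)"
  where "ga_scale c a = Poly_Mapping.map ((*) c) a"

definition ga_mult ::
    "('g, 'x) monoid_scheme \<Rightarrow> ('g \<Rightarrow>\<^sub>0 'k::field) \<Rightarrow> ('g \<Rightarrow>\<^sub>0 'k) \<Rightarrow> ('g \<Rightarrow>\<^sub>0 'k)"
  where "ga_mult G a b =
    (\<Sum>g\<in>Poly_Mapping.keys a. \<Sum>h\<in>Poly_Mapping.keys b.
       Poly_Mapping.single (g \<otimes>\<^bsub>G\<^esub> h) (Poly_Mapping.lookup a g * Poly_Mapping.lookup b h))"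

definition right_mult ::
    "('g, 'x) monoid_scheme \<Rightarrow> ('g \<Rightarrow>\<^sub>0 'k::field) \<Rightarrow> ('g \<Rightarrow>\<^sub>0 'k) \<Rightarrow> ('g \<Rightarrow>\<^sub>0 'k)"
  where "right_mult G x = (\<lambda>y. ga_mult G y x)"

lemma lookup_ga_scale [simp]:
  "Poly_Mapping.lookup (ga_scale c a) g = c * Poly_Mapping.lookup a g"
  by (simp add: ga_scale_def Poly_Mapping.map.rep_eq when_def)

lemma vector_space_ga_scale: "vector_space (ga_scale :: 'k::field \<Rightarrow> ('g \<Rightarrow>\<^sub>0 'k) \<Rightarrow> _)"
  by unfold_locales (auto intro!: poly_mapping_eqI simp: lookup_add algebra_simps)

lemma subspace_group_algebra:
  "Modules.module.subspace ga_scale (group_algebra G :: ('g \<Rightarrow>\<^sub>0 'k::field) set)"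
proof -
  interpret vector_space "ga_scale :: 'k \<Rightarrow> ('g \<Rightarrow>\<^sub>0 'k) \<Rightarrow> _"
    by (rule vector_space_ga_scale)
  show ?thesis
    unfolding subspace_def group_algebra_def
    by (auto simp: in_keys_iff lookup_add subset_iff) (metis add_0)
qed

lemma ga_mult_cong_sets:
  assumes "finite A" "finite B" "Poly_Mapping.keys a \<subseteq> A" "Poly_Mapping.keys b \<subseteq> B"
  shows "ga_mult G a b =
    (\<Sum>g\<in>A. \<Sum>h\<in>B.
       Poly_Mapping.single (g \<otimes>\<^bsub>G\<^esub> h) (Poly_Mapping.lookup a g * Poly_Mapping.lookup b h))"
proof -
  have "(\<Sum>h\<in>Poly_Mapping.keys b.
       Poly_Mapping.single (g \<otimes>\<^bsub>G\<^esub> h) (Poly_Mapping.lookup a g * Poly_Mapping.lookup b h)) =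
     (\<Sum>h\<in>B.
       Poly_Mapping.single (g \<otimes>\<^bsub>G\<^esub> h) (Poly_Mapping.lookup a g * Poly_Mapping.lookup b h))" for g
    using assms by (intro sum.mono_neutral_left) (auto simp: in_keys_iff)
  then show ?thesis
    unfolding ga_mult_def using assms
    by (simp, intro sum.mono_neutral_left) (auto simp: in_keys_iff)
qed

lemma right_mult_closed:
  fixes x y :: "'g \<Rightarrow>\<^sub>0 'k::field"
  assumes "monoid G" "x \<in> group_algebra G" "y \<in> group_algebra G"
  shows "right_mult G x y \<in> group_algebra G"
proof -
  interpret vector_space "ga_scale :: 'k \<Rightarrow> ('g \<Rightarrow>\<^sub>0 'k) \<Rightarrow> _"
    by (rule vector_space_ga_scale)
  have "Poly_Mapping.single (g \<otimes>\<^bsub>G\<^esub> h) (Poly_Mapping.lookup y g * Poly_Mapping.lookup x h)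
      \<in> group_algebra G"
    if "g \<in> Poly_Mapping.keys y" "h \<in> Poly_Mapping.keys x" for g h
    using that assms monoid.m_closed[OF assms(1), of g h]
    by (auto simp: group_algebra_def subset_iff)
  then show ?thesis
    unfolding right_mult_def ga_mult_def
    by (intro subspace_sum[OF subspace_group_algebra])
qed

lemma right_mult_linear:
  fixes x :: "'g \<Rightarrow>\<^sub>0 'k::field"
  shows "Vector_Spaces.linear ga_scale ga_scale (right_mult G x)"
proof -
  have sc: "ga_scale c (Poly_Mapping.single k u) = Poly_Mapping.single k (c * u)" for c u :: 'k and k :: 'g
    by (intro poly_mapping_eqI) (auto simp: lookup_single when_def)
  interpret V: vector_space "ga_scale :: 'k \<Rightarrow> ('g \<Rightarrow>\<^sub>0 'k) \<Rightarrow> _"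
    by (rule vector_space_ga_scale)
  show ?thesis
    unfolding Vector_Spaces.linear_iff
  proof (intro conjI allI vector_space_ga_scale)
    fix a b :: "'g \<Rightarrow>\<^sub>0 'k"
    let ?A = "Poly_Mapping.keys a \<union> Poly_Mapping.keys b"
    have "Poly_Mapping.keys (a + b) \<subseteq> ?A" by (rule keys_add)
    then show "right_mult G x (a + b) = right_mult G x a + right_mult G x b"
      unfolding right_mult_def
      by (simp add: ga_mult_cong_sets[where A = ?A and B = "Poly_Mapping.keys x"]
          lookup_add distrib_right single_add sum.distrib)
  next
    fix c :: 'k and a :: "'g \<Rightarrow>\<^sub>0 'k"
    have "Poly_Mapping.keys (ga_scale c a) \<subseteq> Poly_Mapping.keys a"
      by (auto simp: in_keys_iff)
    then show "right_mult G x (ga_scale c a) = ga_scale c (right_mult G x a)"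
      unfolding right_mult_def
      by (simp add: ga_mult_cong_sets[where A = "Poly_Mapping.keys a" and B = "Poly_Mapping.keys x"]
          V.scale_sum_right sc mult.assoc)
  qed
qed

section \<open>Eigenvalues\<close>

text \<open>
  \<open>V\<close> is meant to be a subspace, for the scalar multiplication \<open>scale\<close>, that is mapped into
  itself by the linear map \<open>f\<close>.
\<close>

definition Spec :: "('k::field \<Rightarrow> 'v::ab_group_add \<Rightarrow> 'v) \<Rightarrow> 'v set \<Rightarrow> ('v \<Rightarrow> 'v) \<Rightarrow> 'k set"
  where "Spec scale V f = {c. \<exists>v\<in>V. v \<noteq> 0 \<and> f v = scale c v}"

section \<open>The elements \<open>t\<^sub>l\<close> and the numbers \<open>m\<^sub>I\<^sub>,\<^sub>l\<close>\<close>

text \<open>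
  \<open>cycle_of_list [i\<^sub>1, \<dots>, i\<^sub>k]\<close> sends each entry to the next one and the last entry to the
  first. The elements of \<open>sym_group n\<close> are the maps permuting \<open>{1..n}\<close> and fixing all other
  natural numbers, multiplied by composition.
\<close>

definition t_elem :: "nat \<Rightarrow> nat \<Rightarrow> (nat \<Rightarrow> nat) \<Rightarrow>\<^sub>0 'k::field"
  where "t_elem n l = (\<Sum>j\<in>{l..n}. Poly_Mapping.single (cycle_of_list [l..<Suc j]) 1)"

definition lacunar :: "nat set \<Rightarrow> bool"
  where "lacunar I \<longleftrightarrow> (\<forall>i\<in>I. Suc i \<notin> I)"

text \<open>
  For finite \<open>I\<close> and \<open>l \<le> n + 1\<close>, the minimum is over a finite nonempty set and is at least
  \<open>l\<close>, so the subtraction on \<open>nat\<close> does not truncate.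
\<close>

definition m_num :: "nat \<Rightarrow> nat set \<Rightarrow> nat \<Rightarrow> nat"
  where "m_num n I l = Min {i \<in> {0} \<union> I \<union> {n + 1}. l \<le> i} - l"

lemma t_elem_in_group_algebra:
  assumes "1 \<le> l"
  shows "t_elem n l \<in> (group_algebra (sym_group n) :: ((nat \<Rightarrow> nat) \<Rightarrow>\<^sub>0 'k::field) set)"
proof -
  interpret vector_space "ga_scale :: 'k \<Rightarrow> ((nat \<Rightarrow> nat) \<Rightarrow>\<^sub>0 'k) \<Rightarrow> _"
    by (rule vector_space_ga_scale)
  have "cycle_of_list [l..<Suc j] permutes {1..n}" if "j \<in> {l..n}" for j
    by (rule permutes_subset[OF cycle_permutes]) (use that assms in auto)
  then show ?thesis
    unfolding t_elem_def
    by (intro subspace_sum[OF subspace_group_algebra]) (auto simp: group_algebra_def sym_group_carrier)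
qed

end

theory Submission
  imports Defs
begin

text \<open>
  The algebra carries a filtration on which all \<open>t\<^sub>l\<close> act triangularly, with the numbers
  \<open>m\<^sub>I\<^sub>,\<^sub>l\<close> on the diagonal.

  For a set \<open>I\<close> let \<open>F(I)\<close> consist of the elements fixed by right multiplication with every
  simple transposition \<open>s\<^sub>x = (x x+1)\<close> such that neither \<open>x\<close> nor \<open>x+1\<close> lies in \<open>I\<close>
  (\<open>young_invariants\<close>). These are the right invariants of the Young subgroup that fixes the points
  of \<open>I\<close> and permutes each of the intervals between them. Order the lacunar sets by the sum of their
  elements. The proof rests on three facts.

  \<^item> On \<open>q \<in> F(I)\<close>, the operator \<open>t\<^sub>l\<close> agrees with the scalar \<open>m\<^sub>I\<^sub>,\<^sub>l\<close> up to a sum of members of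
    \<open>F(J)\<close> with \<open>J\<close> of smaller sum (\<open>t_elem_step\<close>). Let \<open>i\<close> be the first point of \<open>I\<close>, or \<open>n+1\<close>, that is
    at least \<open>l\<close>. A cycle \<open>(l l+1 ... j)\<close> with \<open>j < i\<close> belongs to the Young subgroup, so it fixes
    \<open>q\<close>; there are \<open>i - l = m\<^sub>I\<^sub>,\<^sub>l\<close> of these. Think of a permutation as a deck of cards. The
    other cycles take the card at \<open>l\<close> to position \<open>i\<close> or beyond, and the cards passed move down by
    one, so the dividing points that were passed move down by one too. Adding up
    all destinations of the card within one interval restores the symmetry of that interval (\<open>sum_tail_cycles_in_lower\<close>).

  \<^item> The set \<open>J\<close> found in this way need not be lacunar, but lowering its elements further makes it so, and
    this only enlarges \<open>F(J)\<close> (\<open>lacunar_refinement\<close>).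

  \<^item> No step of the filtration is trivial (\<open>young_invariants_not_lower\<close>). For lacunar \<open>I\<close> the
    transpositions \<open>s\<^sub>x\<close>, \<open>x \<in> I\<close>, commute and generate an elementary abelian group. The alternating
    sum of the coefficients over this group kills every \<open>F(J)\<close> with \<open>J\<close> of smaller sum, but it takes the
    value \<open>1\<close> at the sum of the permutations fixing \<open>I\<close> pointwise, which lies in \<open>F(I)\<close>.

  A triangular operator has exactly its diagonal entries as eigenvalues if each step of the
  filtration is proper (\<open>Spec_of_filtered_operator\<close>).
\<close>

section \<open>Eigenvalues of an operator that is triangular along a filtration\<close>

lemma (in vector_space) span_shift_into_subspace:
  assumes T: "Vector_Spaces.linear scale scale T" and W: "subspace W"
    and gen: "\<And>v. v \<in> S \<Longrightarrow> T v - scale c v \<in> W"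
    and v: "v \<in> span S"
  shows "T v - scale c v \<in> W"
proof -
  interpret T: Vector_Spaces.linear scale scale T by (rule T)
  have "subspace {v. T v - scale c v \<in> W}"
  proof (rule subspaceI)
    show "0 \<in> {v. T v - scale c v \<in> W}"
      using subspace_0[OF W] by (simp add: T.zero)
    fix a b k assume "a \<in> {v. T v - scale c v \<in> W}"
    then have a: "T a - scale c a \<in> W" by simp
    have "T (scale k a) - scale c (scale k a) = scale k (T a - scale c a)"
      by (simp add: T.scale scale_right_diff_distrib scale_left_commute)
    then show "scale k a \<in> {v. T v - scale c v \<in> W}"
      using subspace_scale[OF W a] by simp
    assume "b \<in> {v. T v - scale c v \<in> W}"
    then have b: "T b - scale c b \<in> W" by simp
    have "T (a + b) - scale c (a + b) = (T a - scale c a) + (T b - scale c b)"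
      by (simp add: T.add scale_right_distrib)
    then show "a + b \<in> {v. T v - scale c v \<in> W}"
      using subspace_add[OF W a b] by simp
  qed
  then show ?thesis
    using span_minimal[of S "{v. T v - scale c v \<in> W}"] gen v by auto
qed

text \<open>
  The members \<open>G I\<close> span a filtration indexed by subfamilies of \<open>L\<close> that are closed downwards in rank.
  An eigenvector whose eigenvalue is not among the \<open>c I\<close> is pushed down step by step until it is
  \<open>0\<close>. Conversely, if \<open>T - c I\<close> were injective, it would map each step onto itself,
  although it maps \<open>G I\<close> into the step below; then \<open>G I\<close> would lie in that step.
\<close>

lemma (in vector_space) Spec_of_filtered_operator:
  fixes T :: "'b \<Rightarrow> 'b" and G :: "'i \<Rightarrow> 'b set" and r :: "'i \<Rightarrow> nat"
  assumes T: "Vector_Spaces.linear scale scale T"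
    and fin: "finite L"
    and whole: "V = span (\<Union>I\<in>L. G I)"
    and step: "\<And>I v. I \<in> L \<Longrightarrow> v \<in> G I \<Longrightarrow>
        T v - scale (c I) v \<in> span (\<Union>J\<in>{J\<in>L. r J < r I}. G J)"
    and proper: "\<And>I. I \<in> L \<Longrightarrow> \<not> G I \<subseteq> span (\<Union>J\<in>{J\<in>L. r J < r I}. G J)"
  shows "Spec scale V T = c ` L"
proof -
  interpret T: Vector_Spaces.linear scale scale T by (rule T)
  define H where "H K = span (\<Union>J\<in>K. G J)" for K
  define down where "down K \<longleftrightarrow> K \<subseteq> L \<and> (\<forall>I\<in>K. \<forall>J\<in>L. r J < r I \<longrightarrow> J \<in> K)" for K
  have H_mono: "H A \<subseteq> H B" if "A \<subseteq> B" for A B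
    unfolding H_def using that by (intro span_mono) auto
  have G_H: "v \<in> H K" if "v \<in> G I" "I \<in> K" for v I K
    unfolding H_def using that by (intro span_base) auto
  have sub: "subspace (H K)" for K
    unfolding H_def by simp
  have stepH: "T v - scale (c I) v \<in> H {J\<in>L. r J < r I}" if "I \<in> L" "v \<in> G I" for I v
    unfolding H_def using step[OF that] .
  have stable: "T v \<in> H K" if K: "down K" and v: "v \<in> H K" for K v
  proof -
    have "T u - scale 0 u \<in> H K" if u: "u \<in> (\<Union>J\<in>K. G J)" for u
    proof -
      obtain I where I: "I \<in> K" "u \<in> G I" using u by auto
      then have "I \<in> L" "{J\<in>L. r J < r I} \<subseteq> K" using K by (auto simp: down_def)
      then have "T u - scale (c I) u \<in> H K" using stepH I H_mono by blast
      moreover have "scale (c I) u \<in> H K" using G_H I sub subspace_scale by blast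
      ultimately have "(T u - scale (c I) u) + scale (c I) u \<in> H K"
        using sub subspace_add by blast
      then show ?thesis by simp
    qed
    from span_shift_into_subspace[OF T sub this v[unfolded H_def]] show ?thesis
      by simp
  qed
  \<comment> \<open>Removing a member of maximal rank keeps a family closed downwards, and \<open>T - c I\<close> pushes
    the larger span into the smaller one.\<close>
  have peel: "\<exists>I\<in>K. down (K - {I}) \<and> (\<forall>v\<in>H K. T v - scale (c I) v \<in> H (K - {I}))"
    if K: "down K" "K \<noteq> {}" for K
  proof -
    have finK: "finite K" using K(1) fin finite_subset by (auto simp: down_def)
    obtain I where I: "I \<in> K" "\<And>J. J \<in> K \<Longrightarrow> r J \<le> r I"
    proof -
      have "Max (r ` K) \<in> r ` K" using finK K(2) by (intro Max_in) auto
      then obtain I where "I \<in> K" "r I = Max (r ` K)" by auto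
      with that show ?thesis using finK by (metis Max_ge finite_imageI imageI)
    qed
    have d: "down (K - {I})"
      using K(1) I unfolding down_def by (metis Diff_iff insertE empty_iff not_le subset_iff)
    have "T v - scale (c I) v \<in> H (K - {I})" if v: "v \<in> (\<Union>J\<in>K. G J)" for v
    proof -
      obtain J where J: "J \<in> K" "v \<in> G J" using v by auto
      show ?thesis
      proof (cases "J = I")
        case True
        have "{J\<in>L. r J < r I} \<subseteq> K - {I}" using K(1) I(1) by (auto simp: down_def)
        moreover have "I \<in> L" using K(1) I(1) by (auto simp: down_def)
        ultimately show ?thesis using stepH[of I v] J True H_mono by blast
      next
        case False
        then have vH: "v \<in> H (K - {I})" using J G_H[of v J "K - {I}"] by simp
        show ?thesis
          by (rule subspace_diff[OF sub stable[OF d vH] subspace_scale[OF sub vH]])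
      qed
    qed
    then have "T v - scale (c I) v \<in> H (K - {I})" if "v \<in> H K" for v
      using span_shift_into_subspace[OF T sub _ that[unfolded H_def]] by blast
    then show ?thesis using I(1) d by blast
  qed
  have down_induct: "P K" if K: "down K" and P0: "P {}"
    and PI: "\<And>K I. down K \<Longrightarrow> I \<in> K \<Longrightarrow> down (K - {I}) \<Longrightarrow>
        (\<And>v. v \<in> H K \<Longrightarrow> T v - scale (c I) v \<in> H (K - {I})) \<Longrightarrow> P (K - {I}) \<Longrightarrow> P K"
    for P K
    using K
  proof (induction "card K" arbitrary: K rule: less_induct)
    case less
    show ?case
    proof (cases "K = {}")
      case False
      have finK: "finite K" using less.prems fin finite_subset by (auto simp: down_def)
      from peel[OF less.prems False] obtain I where I: "I \<in> K" "down (K - {I})"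
        "\<And>v. v \<in> H K \<Longrightarrow> T v - scale (c I) v \<in> H (K - {I})" by blast
      have "P (K - {I})"
        using I(1,2) finK by (intro less.hyps card_Diff1_less)
      then show ?thesis using PI[OF less.prems I(1,2)] I(3) by simp
    qed (simp add: P0)
  qed
  have downL: "down L" by (simp add: down_def)
  have H_empty: "H {} = {0}" by (simp add: H_def)

  have no_other: "v = 0" if cL: "e \<notin> c ` L" and ev: "T v = scale e v" and v: "v \<in> H L" for e v
  proof -
    have "v \<in> H L \<longrightarrow> v = 0"
    proof (rule down_induct[OF downL, where P = "\<lambda>K. v \<in> H K \<longrightarrow> v = 0"])
      fix K I
      assume K: "down K" "I \<in> K" "down (K - {I})"
        "\<And>v. v \<in> H K \<Longrightarrow> T v - scale (c I) v \<in> H (K - {I})"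
        and IH: "v \<in> H (K - {I}) \<longrightarrow> v = 0"
      have ne: "e - c I \<noteq> 0" using cL K(1,2) by (auto simp: down_def)
      show "v \<in> H K \<longrightarrow> v = 0"
      proof
        assume "v \<in> H K"
        then have "scale (e - c I) v \<in> H (K - {I})"
          using K(4)[of v] by (simp add: ev scale_left_diff_distrib)
        then have "scale (inverse (e - c I)) (scale (e - c I) v) \<in> H (K - {I})"
          using sub subspace_scale by blast
        then show "v = 0" using IH ne by simp
      qed
    qed (simp add: H_empty)
    with v show ?thesis by simp
  qed

  have all_occur: "\<exists>v\<in>H L. v \<noteq> 0 \<and> T v = scale (c I) v" if I: "I \<in> L" for I
  proof (rule ccontr)
    define D where "D v = T v - scale (c I) v" for v
    assume "\<not> ?thesis"
    then have ker: "v = 0" if "v \<in> H L" "D v = 0" for v using that by (auto simp: D_def)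
    have D_diff: "D (u - v) = D u - D v" for u v
      by (simp add: D_def T.diff scale_right_diff_distrib)
    have D_scale: "D (scale k v) = scale k (D v)" for k v
      by (simp add: D_def T.scale scale_right_diff_distrib scale_left_commute)
    have inj: "u = v" if "u \<in> H L" "v \<in> H L" "D u = D v" for u v
      using ker[of "u - v"] that sub subspace_diff D_diff by (metis eq_iff_diff_eq_0)
    \<comment> \<open>An injective \<open>D\<close> maps every step of the filtration onto itself. Where the diagonal entry
      vanishes, this forces the step to be trivial.\<close>
    have onto: "H K \<subseteq> D ` H K" if "down K" for K
    proof (rule down_induct[OF that, where P = "\<lambda>K. H K \<subseteq> D ` H K"])
      show "H {} \<subseteq> D ` H {}" by (simp add: H_empty D_def T.zero)
    next
      fix K J
      assume K: "down K" "J \<in> K" "down (K - {J})"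
        "\<And>v. v \<in> H K \<Longrightarrow> T v - scale (c J) v \<in> H (K - {J})"
        and IH: "H (K - {J}) \<subseteq> D ` H (K - {J})"
      have KL: "H K \<subseteq> H L" using K(1) H_mono by (auto simp: down_def)
      have KJ: "H (K - {J}) \<subseteq> H K" by (intro H_mono) auto
      show "H K \<subseteq> D ` H K"
      proof
        fix v assume v: "v \<in> H K"
        from K(4)[OF v] IH obtain u where
          u: "u \<in> H (K - {J})" "T v - scale (c J) v = D u" by blast
        show "v \<in> D ` H K"
        proof (cases "c J = c I")
          case True
          then have "D v = D u" using u by (simp add: D_def)
          then have "v = u" using inj u(1) v KL KJ by blast
          then show ?thesis using u(1) IH KJ by blast
        next
          case False
          define k where "k = c I - c J"
          have "T v - scale (c J) v = D v + scale k v"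
            by (simp add: D_def k_def scale_left_diff_distrib)
          then have "scale k v = D (u - v)" using u(2) D_diff[of u v] by (metis add_diff_cancel_left')
          then have "scale (inverse k) (scale k v) = D (scale (inverse k) (u - v))"
            by (simp add: D_scale)
          moreover have "k \<noteq> 0" using False by (simp add: k_def)
          ultimately have "v = D (scale (inverse k) (u - v))" by simp
          moreover have "scale (inverse k) (u - v) \<in> H K"
            using u(1) v KJ sub subspace_scale subspace_diff by blast
          ultimately show ?thesis by blast
        qed
      qed
    qed
    define K where "K = {J\<in>L. r J < r I}"
    have K: "down K" by (auto simp: K_def down_def)
    obtain v where v: "v \<in> G I" "v \<notin> H K"
      using proper[OF I] unfolding K_def H_def by blast
    have "D v \<in> H K" using stepH[OF I v(1)] by (simp add: D_def K_def)
    then obtain u where u: "u \<in> H K" "D v = D u" using onto[OF K] by blast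
    have "v \<in> H L" using G_H v(1) I by blast
    moreover have "u \<in> H L" using u(1) H_mono[of K L] K by (auto simp: down_def)
    ultimately have "v = u" using inj u(2) by blast
    with u(1) v(2) show False by simp
  qed
  show ?thesis
    unfolding Spec_def whole using no_other all_occur unfolding H_def by blast
qed

section \<open>Right translation by a permutation\<close>

definition translate :: "('a \<Rightarrow> 'a) \<Rightarrow> (('a \<Rightarrow> 'a) \<Rightarrow>\<^sub>0 'k::field) \<Rightarrow> (('a \<Rightarrow> 'a) \<Rightarrow>\<^sub>0 'k)"
  where "translate s q =
    (\<Sum>g\<in>Poly_Mapping.keys q. Poly_Mapping.single (g \<circ> s) (Poly_Mapping.lookup q g))"

lemma right_mult_single:
  "right_mult (sym_group n) (Poly_Mapping.single s 1) = translate s"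
  by (rule ext) (simp add: right_mult_def translate_def ga_mult_def sym_group_mult)

lemma linear_translate: "Vector_Spaces.linear ga_scale ga_scale (translate s :: _ \<Rightarrow> ((nat \<Rightarrow> nat) \<Rightarrow>\<^sub>0 'k::field))"
  using right_mult_linear[of "sym_group 0" "Poly_Mapping.single s (1::'k)"]
  by (simp add: right_mult_single)

interpretation ga: vector_space "ga_scale :: 'k::field \<Rightarrow> ('g \<Rightarrow>\<^sub>0 'k) \<Rightarrow> _"
  by (rule vector_space_ga_scale)

interpretation tr: Vector_Spaces.linear ga_scale ga_scale
  "translate s :: _ \<Rightarrow> ((nat \<Rightarrow> nat) \<Rightarrow>\<^sub>0 'k::field)"
  by (rule linear_translate)

text \<open>Coefficientwise, right translation is precomposition with the inverse, so identities between
  translates reduce to identities between permutations.\<close>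

lemma lookup_translate:
  assumes "bij s"
  shows "Poly_Mapping.lookup (translate s q) h = Poly_Mapping.lookup q (h \<circ> inv_into UNIV s)"
proof -
  have eq: "g \<circ> s = h \<longleftrightarrow> g = h \<circ> inv_into UNIV s" for g
    using assms by (metis bij_is_inj bij_is_surj comp_assoc comp_id inv_o_cancel surj_iff)
  have "Poly_Mapping.lookup (translate s q) h =
      (\<Sum>g\<in>Poly_Mapping.keys q. if g = h \<circ> inv_into UNIV s then Poly_Mapping.lookup q g else 0)"
    by (simp add: translate_def lookup_sum lookup_single when_def eq)
  also have "\<dots> = Poly_Mapping.lookup q (h \<circ> inv_into UNIV s)"
    by (simp add: in_keys_iff)
  finally show ?thesis .
qed

lemma translate_id [simp]: "translate id q = q"
  by (rule poly_mapping_eqI) (simp add: lookup_translate)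

lemma translate_comp:
  assumes "bij s" "bij u"
  shows "translate (s \<circ> u) q = translate u (translate s q)"
  using assms by (intro poly_mapping_eqI) (simp add: lookup_translate bij_comp o_inv_distrib comp_assoc)

lemma translate_in_group_algebra:
  assumes "s permutes {1..n}" "q \<in> group_algebra (sym_group n)"
  shows "translate s q \<in> (group_algebra (sym_group n) :: ((nat \<Rightarrow> nat) \<Rightarrow>\<^sub>0 'k::field) set)"
proof -
  have "Poly_Mapping.single s 1 \<in> (group_algebra (sym_group n) :: ((nat \<Rightarrow> nat) \<Rightarrow>\<^sub>0 'k) set)"
    using assms by (auto simp: group_algebra_def sym_group_carrier)
  from right_mult_closed[OF _ this assms(2)] show ?thesis
    by (simp add: right_mult_single sym_group_is_group group.is_monoid)
qed

lemma right_mult_add: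
  "right_mult G (x + y) q = right_mult G x q + right_mult G y q"
proof -
  let ?B = "Poly_Mapping.keys x \<union> Poly_Mapping.keys y"
  have "Poly_Mapping.keys (x + y) \<subseteq> ?B" by (rule keys_add)
  then show ?thesis
    unfolding right_mult_def
    by (simp add: ga_mult_cong_sets[where A = "Poly_Mapping.keys q" and B = ?B]
        lookup_add distrib_left single_add sum.distrib)
qed

lemma right_mult_sum:
  "right_mult G (\<Sum>i\<in>A. f i) q = (\<Sum>i\<in>A. right_mult G (f i) q)"
proof (induction A rule: infinite_finite_induct)
  case (insert i A)
  then show ?case by (simp add: right_mult_add)
qed (simp_all add: right_mult_def ga_mult_def)

lemma right_mult_scale:
  fixes x q :: "'g \<Rightarrow>\<^sub>0 'k::field"
  shows "right_mult G (ga_scale c x) q = ga_scale c (right_mult G x q)"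
proof -
  have "Poly_Mapping.keys (ga_scale c x) \<subseteq> Poly_Mapping.keys x"
    by (auto simp: in_keys_iff)
  moreover have "ga_scale c (Poly_Mapping.single k u) = Poly_Mapping.single k (c * u)" for k :: 'g and u
    by (intro poly_mapping_eqI) (auto simp: lookup_single when_def)
  ultimately show ?thesis
    unfolding right_mult_def
    by (simp add: ga_mult_cong_sets[where A = "Poly_Mapping.keys q" and B = "Poly_Mapping.keys x"]
        ga.scale_sum_right mult.left_commute)
qed

section \<open>The cycles on intervals\<close>

definition cyc :: "nat \<Rightarrow> nat \<Rightarrow> nat \<Rightarrow> nat"
  where "cyc l j = cycle_of_list [l..<Suc j]"

abbreviation adj :: "nat \<Rightarrow> nat \<Rightarrow> nat"
  where "adj x \<equiv> transpose x (Suc x)"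

lemma cyc_rec: "l < j \<Longrightarrow> cyc l j = adj l \<circ> cyc (Suc l) j"
  unfolding cyc_def by (simp add: upt_conv_Cons del: upt_Suc)

lemma cyc_self [simp]: "cyc l l = id"
  by (simp add: cyc_def)

text \<open>This is stated with the whole case distinction so that all relations between cycles and simple
  transpositions below can be checked pointwise.\<close>

lemma cyc_apply:
  assumes "l \<le> j"
  shows "cyc l j z = (if l \<le> z \<and> z < j then Suc z else if z = j then l else z)"
  using assms
proof (induction "j - l" arbitrary: l z)
  case 0
  then show ?case by auto
next
  case (Suc d)
  have "cyc (Suc l) j z = (if Suc l \<le> z \<and> z < j then Suc z else if z = j then Suc l else z)"
    using Suc by (intro Suc.hyps) auto
  then show ?case using Suc by (auto simp: cyc_rec transpose_def)
qed

lemma cyc_permutes: "1 \<le> l \<Longrightarrow> j \<le> n \<Longrightarrow> cyc l j permutes {1..n}"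
  unfolding cyc_def by (rule permutes_subset[OF cycle_permutes]) auto

lemma bij_cyc: "bij (cyc l j)"
  unfolding cyc_def using cycle_permutes permutes_bij by blast

lemma cyc_Suc: "l \<le> j \<Longrightarrow> cyc l (Suc j) = cyc l j \<circ> adj j"
  by (rule ext) (auto simp: cyc_apply transpose_def)

lemma cyc_comp: "l \<le> i \<Longrightarrow> i \<le> j \<Longrightarrow> cyc l j = cyc l i \<circ> cyc i j"
  by (rule ext) (auto simp: cyc_apply)

lemma cyc_adj_outside: "l \<le> j \<Longrightarrow> Suc x < l \<or> j < x \<Longrightarrow> cyc l j \<circ> adj x = adj x \<circ> cyc l j"
  by (rule ext) (auto simp: cyc_apply transpose_def)

lemma cyc_adj_inside: "l \<le> x \<Longrightarrow> Suc x < j \<Longrightarrow> cyc l j \<circ> adj x = adj (Suc x) \<circ> cyc l j"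
  by (rule ext) (auto simp: cyc_apply transpose_def)

lemma cyc_adj_last: "l \<le> x \<Longrightarrow> cyc l (Suc x) \<circ> adj x = cyc l x"
  by (rule ext) (auto simp: cyc_apply transpose_def)

lemma adj_permutes: "1 \<le> x \<Longrightarrow> x < n \<Longrightarrow> adj x permutes {1..n}"
  by (rule permutes_swap_id) auto

lemma right_mult_t_elem:
  "right_mult (sym_group n) (t_elem n l) q = (\<Sum>j\<in>{l..n}. translate (cyc l j) q)"
  unfolding t_elem_def right_mult_sum right_mult_single cyc_def ..

section \<open>The filtration by invariants of Young subgroups\<close>

text \<open>\<open>gaps n I\<close> indexes the simple transpositions of the Young subgroup whose blocks are the
  points of \<open>I\<close> and the intervals between them.\<close>

definition gaps :: "nat \<Rightarrow> nat set \<Rightarrow> nat set"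
  where "gaps n I = {x \<in> {1..n - 1}. x \<notin> I \<and> Suc x \<notin> I}"

definition young_invariants :: "nat \<Rightarrow> nat set \<Rightarrow> ((nat \<Rightarrow> nat) \<Rightarrow>\<^sub>0 'k::field) set"
  where "young_invariants n I =
    {q \<in> group_algebra (sym_group n). \<forall>x\<in>gaps n I. translate (adj x) q = q}"

definition lacunar_sets :: "nat \<Rightarrow> nat set set"
  where "lacunar_sets n = {I. I \<subseteq> {1..n - 1} \<and> lacunar I}"

definition lower :: "nat \<Rightarrow> nat set \<Rightarrow> ((nat \<Rightarrow> nat) \<Rightarrow>\<^sub>0 'k::field) set"
  where "lower n I = ga.span (\<Union>J\<in>{J \<in> lacunar_sets n. \<Sum>J < \<Sum>I}. young_invariants n J)"

lemma translate_cyc_adj: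
  assumes "cyc l j \<circ> adj x = adj y \<circ> cyc l j" "translate (adj y) q = q"
  shows "translate (adj x) (translate (cyc l j) q) = translate (cyc l j) q"
proof -
  have "translate (adj x) (translate (cyc l j) q) = translate (cyc l j \<circ> adj x) q"
    by (simp add: translate_comp bij_cyc)
  also have "\<dots> = translate (cyc l j) (translate (adj y) q)"
    by (simp add: assms(1) translate_comp bij_cyc)
  finally show ?thesis by (simp add: assms(2))
qed

lemma translate_cyc_Suc:
  "l \<le> j \<Longrightarrow> translate (cyc l (Suc j)) q = translate (adj j) (translate (cyc l j) q)"
  unfolding cyc_Suc by (rule translate_comp) (simp_all add: bij_cyc)

text \<open>
  If \<open>a\<close> and \<open>a+1\<close> both lie in \<open>J\<close>, replace \<open>a\<close> by \<open>a-1\<close>, or drop it if that is \<open>0\<close>. The gaps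
  destroyed by \<open>a\<close> are those at \<open>a-1\<close> and \<open>a\<close>; they stay destroyed, by \<open>a-1\<close> and \<open>a+1\<close>. The sum
  decreases, so the process ends.
\<close>

lemma lacunar_refinement:
  assumes "J \<subseteq> {1..n - 1}"
  obtains K where "K \<in> lacunar_sets n" "\<Sum>K \<le> \<Sum>J" "gaps n K \<subseteq> gaps n J"
proof -
  have "\<exists>K\<in>lacunar_sets n. \<Sum>K \<le> \<Sum>J \<and> gaps n K \<subseteq> gaps n J"
    using assms
  proof (induction "\<Sum>J" arbitrary: J rule: less_induct)
    case less
    have fin: "finite J" using less.prems finite_subset by blast
    show ?case
    proof (cases "lacunar J")
      case True
      then show ?thesis using less.prems by (auto simp: lacunar_sets_def)
    next
      case False
      then obtain a where a: "a \<in> J" "Suc a \<in> J" by (auto simp: lacunar_def)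
      have a1: "1 \<le> a" using a less.prems by auto
      define J' where "J' = (J - {a}) \<union> ({a - 1} - {0})"
      have sub: "J' \<subseteq> {1..n - 1}" using less.prems a a1 by (auto simp: J'_def subset_iff)
      have "\<Sum>J' \<le> \<Sum>(J - {a}) + \<Sum>({a - 1} - {0})"
        unfolding J'_def using fin by (simp add: sum_Un_nat)
      also have "\<Sum>({a - 1} - {0}) = a - 1"
        by (cases "a - 1 = 0") (simp_all add: insert_Diff_if)
      also have "\<Sum>(J - {a}) + (a - 1) < \<Sum>J"
        using a(1) a1 fin by (simp add: sum.remove[of J a])
      finally have lt: "\<Sum>J' < \<Sum>J" .
      have "gaps n J' \<subseteq> gaps n J"
      proof
        fix x assume x: "x \<in> gaps n J'"
        then have "x \<noteq> a" using a by (auto simp: gaps_def J'_def)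
        moreover have "Suc x \<noteq> a" using x by (auto simp: gaps_def J'_def)
        ultimately show "x \<in> gaps n J" using x by (auto simp: gaps_def J'_def)
      qed
      then show ?thesis using less.hyps[OF lt sub] lt by (meson dual_order.trans less_imp_le)
    qed
  qed
  then show ?thesis using that by blast
qed

lemma young_invariants_antimono: "gaps n K \<subseteq> gaps n J \<Longrightarrow> young_invariants n J \<subseteq> young_invariants n K"
  by (auto simp: young_invariants_def)

text \<open>The set \<open>J\<close> may contain \<open>0\<close>, which is where a divider at \<open>1\<close> ends up when it moves down by one;
  \<open>0\<close> affects neither the gaps nor the sum.\<close>

lemma lower_memI:
  assumes "J \<subseteq> {..n - 1}" "\<Sum>J < \<Sum>I" "q \<in> young_invariants n J"
  shows "q \<in> lower n I"
proof -
  have fin: "finite J" using assms(1) finite_subset by blast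
  have "J - {0} \<subseteq> {1..n - 1}" using assms(1) by auto
  then obtain K where K: "K \<in> lacunar_sets n" "\<Sum>K \<le> \<Sum>(J - {0})" "gaps n K \<subseteq> gaps n (J - {0})"
    by (rule lacunar_refinement)
  have "gaps n (J - {0}) = gaps n J" by (auto simp: gaps_def)
  with K assms(3) have "q \<in> young_invariants n K" using young_invariants_antimono by blast
  moreover have "\<Sum>(J - {0}) \<le> \<Sum>J" using fin by (intro sum_mono2) auto
  then have "\<Sum>K < \<Sum>I" using K(2) assms(2) by linarith
  ultimately show ?thesis
    unfolding lower_def using K(1) by (intro ga.span_base UN_I[of K]) simp_all
qed

lemma subspace_lower: "ga.subspace (lower n I)"
  by (simp add: lower_def)

text \<open>
  The card at the divider \<open>i\<close> is inserted at any position \<open>j \<ge> i\<close>. Group the terms by the last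
  divider \<open>e \<le> j\<close>. In such a group all cards in \<open>(i, e]\<close> move down by one, hence the dividers in \<open>[i, e]\<close>
  do as well. The card itself runs through all positions from \<open>e\<close> to just before the next divider, and so
  becomes symmetric with the cards of that interval. The transposition with \<open>x + 2 = i\<close> is excepted in the
  hypothesis because the lemma is meant for elements that were already disturbed next to \<open>i\<close>; it
  touches \<open>i - 1\<close>, which is a divider of the result.
\<close>

lemma sum_tail_cycles_in_lower:
  fixes q :: "(nat \<Rightarrow> nat) \<Rightarrow>\<^sub>0 'k::field"
  assumes I: "I \<subseteq> {1..n - 1}" and i: "i \<in> I"
    and q: "q \<in> group_algebra (sym_group n)"
    and inv: "\<And>x. x \<in> gaps n I \<Longrightarrow> x + 2 \<noteq> i \<Longrightarrow> translate (adj x) q = q"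
  shows "(\<Sum>j\<in>{i..n}. translate (cyc i j) q) \<in> lower n I"
proof -
  have fin: "finite I" using I finite_subset by blast
  have i1: "1 \<le> i" "i \<le> n - 1" using I i by auto
  define f where "f j = Max {y\<in>I. y \<le> j}" for j
  have f: "f j \<in> I \<and> f j \<le> j \<and> (\<forall>y\<in>I. y \<le> j \<longrightarrow> y \<le> f j)" if "i \<le> j" for j
  proof -
    have "finite {y\<in>I. y \<le> j}" "{y\<in>I. y \<le> j} \<noteq> {}" using fin i that by auto
    from Max_in[OF this] Max_ge[OF this(1)] show ?thesis by (auto simp: f_def)
  qed
  have "(\<Sum>j\<in>{j\<in>{i..n}. f j = e}. translate (cyc i j) q) \<in> lower n I" if e: "e \<in> I" "i \<le> e" for e
  proof -
    define A where "A = {j\<in>{i..n}. f j = e}"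
    have A: "j \<in> A \<longleftrightarrow> e \<le> j \<and> j \<le> n \<and> (\<forall>y\<in>I. y \<le> j \<longrightarrow> y \<le> e)" for j
      unfolding A_def using f[of j] e by (auto intro: antisym)
    define J where "J = (\<lambda>y. if i \<le> y \<and> y \<le> e then y - 1 else y) ` I"
    have shifted: "z = (if i \<le> y \<and> y \<le> e then y - 1 else y) \<longleftrightarrow>
        (i \<le> y \<and> y \<le> e \<and> y = Suc z) \<or> (\<not> (i \<le> y \<and> y \<le> e) \<and> y = z)" for y z
      using i1(1) by auto
    have J_iff: "z \<in> J \<longleftrightarrow> (z \<in> I \<and> (z < i \<or> e < z)) \<or> (Suc z \<in> I \<and> i \<le> Suc z \<and> Suc z \<le> e)" for z
      unfolding J_def image_iff shifted by (auto simp: not_le)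
    have "\<Sum>J \<le> (\<Sum>y\<in>I. if i \<le> y \<and> y \<le> e then y - 1 else y)"
      unfolding J_def using sum_image_le[OF fin, of "\<lambda>x. x" "\<lambda>y. if i \<le> y \<and> y \<le> e then y - 1 else y"]
      by (simp add: comp_def)
    also have "\<dots> < \<Sum>I"
      using fin i i1 e by (intro sum_strict_mono_ex1) auto
    finally have less: "\<Sum>J < \<Sum>I" .
    have "y \<le> n - 1" if "y \<in> I" for y using I that by auto
    then have J_sub: "J \<subseteq> {..n - 1}" by (auto simp: J_def intro: le_trans[OF diff_le_self])
    have "(\<Sum>j\<in>A. translate (cyc i j) q) \<in> young_invariants n J"
      unfolding young_invariants_def
    proof (intro CollectI conjI ballI)
      show "(\<Sum>j\<in>A. translate (cyc i j) q) \<in> group_algebra (sym_group n)"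
        using q i1 by (intro ga.subspace_sum[OF subspace_group_algebra] translate_in_group_algebra cyc_permutes)
          (auto simp: A)
      fix x assume "x \<in> gaps n J"
      then have x: "1 \<le> x" "x < n" "x \<notin> J" "Suc x \<notin> J" by (auto simp: gaps_def)
      \<comment> \<open>Multiplying with the transposition at \<open>x\<close> exchanges the terms for \<open>x\<close> and \<open>Suc x\<close> if both
        occur in the group, and otherwise fixes each term.\<close>
      define s where "s = (if x \<in> A \<and> Suc x \<in> A then adj x else id)"
      have gap: "y \<in> gaps n I" if "1 \<le> y" "y < n" "y \<notin> I" "Suc y \<notin> I" for y
        using that by (auto simp: gaps_def)
      have term_eq: "translate (adj x) (translate (cyc i j) q) = translate (cyc i (s j)) q"
        if j: "j \<in> A" for j
      proof -
        have ij: "i \<le> j" "e \<le> j" "j \<le> n" using j e by (auto simp: A)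
        have xI: "x \<notin> {i - 1, e - 1}" using x i i1 e by (auto simp: J_iff)
        consider "Suc x < i" | "i \<le> x" "Suc x < e" | "e \<le> x" "Suc x < j" | "e \<le> x" "Suc x = j"
          | "e \<le> x" "x = j" | "j < x"
          using xI e i1 by force
        then show ?thesis
        proof cases
          case 1
          then have "x \<notin> I" "Suc x \<notin> I" "x + 2 \<noteq> i"
            using x e i i1 J_iff[of x] J_iff[of "Suc x"] by auto
          then have "translate (adj x) q = q" using inv gap x by auto
          moreover have "s j = j" using 1 e by (auto simp: s_def A)
          ultimately show ?thesis
            using translate_cyc_adj[OF cyc_adj_outside] ij 1 by auto
        next
          case 2
          then have "Suc x \<notin> I" "Suc (Suc x) \<notin> I"
            using x J_iff[of x] J_iff[of "Suc x"] by auto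
          then have "translate (adj (Suc x)) q = q" using inv gap[of "Suc x"] x 2 ij by auto
          moreover have "s j = j" "Suc x < j" using 2 ij by (auto simp: s_def A)
          ultimately show ?thesis
            using translate_cyc_adj[OF cyc_adj_inside] 2 by simp
        next
          case 3
          then have "Suc x \<notin> I" "Suc (Suc x) \<notin> I" using j by (auto simp: A)
          then have "translate (adj (Suc x)) q = q" using inv gap[of "Suc x"] x 3 ij e by auto
          moreover have "s j = j" "i \<le> x" using 3 e by (auto simp: s_def transpose_def)
          ultimately show ?thesis
            using translate_cyc_adj[OF cyc_adj_inside] 3 by simp
        next
          case 4
          then have "x \<in> A" using j by (auto simp: A)
          then have "s j = x" using 4 j by (auto simp: s_def)
          moreover have "cyc i j \<circ> adj x = cyc i x" using 4 e cyc_adj_last[of i x] by simp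
          ultimately show ?thesis by (simp add: translate_comp[symmetric] bij_cyc)
        next
          case 5
          have "Suc x \<notin> I" using 5 x J_iff[of "Suc x"] j by (auto simp: A)
          then have "Suc x \<in> A" using 5 j x by (auto simp: A le_Suc_eq)
          then have "s j = Suc x" using 5 j by (auto simp: s_def)
          moreover have "cyc i j \<circ> adj x = cyc i (Suc x)" using 5 ij cyc_Suc[of i x] by simp
          ultimately show ?thesis by (simp add: translate_comp[symmetric] bij_cyc)
        next
          case 6
          have "x \<notin> I" "Suc x \<notin> I" using 6 ij x J_iff[of x] J_iff[of "Suc x"] by auto
          then have "translate (adj x) q = q" using inv gap x 6 ij by auto
          moreover have "s j = j" using 6 by (auto simp: s_def transpose_def)
          ultimately show ?thesis
            using translate_cyc_adj[OF cyc_adj_outside] ij 6 by auto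
        qed
      qed
      have s: "bij_betw s A A"
      proof -
        have "s permutes A" unfolding s_def by (auto intro: permutes_swap_id)
        then show ?thesis by (rule permutes_imp_bij)
      qed
      have "translate (adj x) (\<Sum>j\<in>A. translate (cyc i j) q) =
          (\<Sum>j\<in>A. translate (cyc i (s j)) q)"
        by (simp add: tr.sum term_eq)
      also have "\<dots> = (\<Sum>j\<in>A. translate (cyc i j) q)"
        using s by (rule sum.reindex_bij_betw)
      finally show "translate (adj x) (\<Sum>j\<in>A. translate (cyc i j) q) = \<dots>" .
    qed
    with J_sub less have "(\<Sum>j\<in>A. translate (cyc i j) q) \<in> lower n I" by (intro lower_memI)
    then show ?thesis by (simp add: A_def)
  qed
  then have "(\<Sum>e\<in>{e\<in>I. i \<le> e}. \<Sum>j\<in>{j\<in>{i..n}. f j = e}. translate (cyc i j) q) \<in> lower n I"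
    by (rule ga.subspace_sum[OF subspace_lower]) auto
  moreover have "(\<Sum>e\<in>{e\<in>I. i \<le> e}. \<Sum>j\<in>{j\<in>{i..n}. f j = e}. translate (cyc i j) q) =
      (\<Sum>j\<in>{i..n}. translate (cyc i j) q)"
    using fin f i by (intro sum.group) auto
  ultimately show ?thesis by simp
qed

lemma sum_constant_ga_scale: "finite A \<Longrightarrow> (\<Sum>j\<in>A. q) = ga_scale (of_nat (card A)) q"
  by (induction A rule: finite_induct) (simp_all add: ga.scale_left_distrib)

text \<open>
  Once the cycles that stay below \<open>i\<close> are split off, each remaining one factors as
  \<open>(l ... i) (i ... j)\<close>. Since \<open>(l ... i-1)\<close> fixes \<open>q\<close>, the first factor acts on \<open>q\<close> as the single
  transposition \<open>(i-1 i)\<close>, or trivially if \<open>l = i\<close>. It therefore preserves the invariance of \<open>q\<close>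
  except possibly under the transposition \<open>(i-2 i-1)\<close>.
\<close>

lemma t_elem_step:
  fixes q :: "(nat \<Rightarrow> nat) \<Rightarrow>\<^sub>0 'k::field"
  assumes I: "I \<in> lacunar_sets n" and l: "1 \<le> l" "l \<le> n" and q: "q \<in> young_invariants n I"
  shows "(\<Sum>j\<in>{l..n}. translate (cyc l j) q) - ga_scale (of_nat (m_num n I l)) q \<in> lower n I"
proof -
  have I_sub: "I \<subseteq> {1..n - 1}" using I by (simp add: lacunar_sets_def)
  have fin: "finite I" using I_sub finite_subset by blast
  define S where "S = {i \<in> {0} \<union> I \<union> {n + 1}. l \<le> i}"
  define i where "i = Min S"
  have S: "finite S" "S \<noteq> {}" using fin l by (auto simp: S_def)
  have "i \<in> S" unfolding i_def using S by (rule Min_in)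
  then have i: "l \<le> i" "i = n + 1 \<or> i \<in> I" using l by (auto simp: S_def)
  have i_le: "i \<le> n + 1" using i subsetD[OF I_sub, of i] by auto
  have gap: "y \<notin> I" if "l \<le> y" "y < i" for y
    using Min_le[OF S(1), of y] that by (auto simp: i_def S_def)
  have m: "m_num n I l = i - l" by (simp add: m_num_def i_def S_def)
  have inv: "translate (adj x) q = q" if "x \<in> gaps n I" for x
    using q that by (simp add: young_invariants_def)
  have low: "translate (cyc l j) q = q" if "l \<le> j" "j < i" for j
    using that
  proof (induction rule: dec_induct)
    case (step j)
    have "j \<in> gaps n I" using step gap[of j] gap[of "Suc j"] l i_le by (auto simp: gaps_def)
    then show ?case using step inv[of j] by (simp add: translate_cyc_Suc)
  qed simp
  have "{l..n} = {l..<i} \<union> {i..n}" using i(1) i_le by auto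
  then have "(\<Sum>j\<in>{l..n}. translate (cyc l j) q) =
      (\<Sum>j\<in>{l..<i}. translate (cyc l j) q) + (\<Sum>j\<in>{i..n}. translate (cyc l j) q)"
    by (simp add: sum.union_disjoint ivl_disj_int)
  also have "(\<Sum>j\<in>{l..<i}. translate (cyc l j) q) = (\<Sum>j\<in>{l..<i}. q)"
    using low by (intro sum.cong) auto
  also have "\<dots> = ga_scale (of_nat (m_num n I l)) q"
    by (simp add: sum_constant_ga_scale m)
  finally have eq: "(\<Sum>j\<in>{l..n}. translate (cyc l j) q) - ga_scale (of_nat (m_num n I l)) q =
      (\<Sum>j\<in>{i..n}. translate (cyc l j) q)" by simp
  have "(\<Sum>j\<in>{i..n}. translate (cyc l j) q) \<in> lower n I"
  proof (cases "i \<in> I")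
    case False
    then show ?thesis using i ga.subspace_0[OF subspace_lower] by simp
  next
    case True
    define p where "p = translate (cyc l i) q"
    have "i \<le> n" using subsetD[OF I_sub True] by auto
    then have "p \<in> group_algebra (sym_group n)"
      unfolding p_def using q l by (intro translate_in_group_algebra cyc_permutes)
        (auto simp: young_invariants_def)
    moreover have "translate (adj x) p = p" if x: "x \<in> gaps n I" "x + 2 \<noteq> i" for x
    proof (cases "l = i")
      case True
      then show ?thesis using inv x by (simp add: p_def)
    next
      case False
      then obtain k where k: "i = Suc k" "l \<le> k" using i(1) by (metis le_neq_implies_less less_eq_Suc_le less_imp_Suc_add le_add1 add_Suc)
      have p: "p = translate (adj k) q"
        using low[of k] k by (simp add: p_def translate_cyc_Suc)
      have "Suc x < k \<or> Suc k < x" using x True k by (auto simp: gaps_def) (metis Suc_lessI not_less_eq)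
      then have "adj k \<circ> adj x = adj x \<circ> adj k"
        by (intro ext) (auto simp: transpose_def)
      then have "translate (adj x) p = translate (adj k) (translate (adj x) q)"
        by (simp add: p translate_comp[symmetric])
      then show ?thesis using inv x p by simp
    qed
    ultimately have "(\<Sum>j\<in>{i..n}. translate (cyc i j) p) \<in> lower n I"
      using True I_sub by (intro sum_tail_cycles_in_lower)
    moreover have "translate (cyc l j) q = translate (cyc i j) p" if "j \<in> {i..n}" for j
      using that i(1) cyc_comp[of l i j] by (simp add: p_def translate_comp bij_cyc)
    ultimately show ?thesis by simp
  qed
  with eq show ?thesis by simp
qed

section \<open>The filtration is strict\<close>

text \<open>For lacunar \<open>K\<close> this is the product of the commuting transpositions \<open>(x x+1)\<close> with \<open>x \<in> K\<close>; the
  explicit formula avoids a product over a set.\<close>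

definition swaps :: "nat set \<Rightarrow> nat \<Rightarrow> nat"
  where "swaps K z = (if z \<in> K then Suc z else if 1 \<le> z \<and> z - 1 \<in> K then z - 1 else z)"

definition alternating_sum :: "nat set \<Rightarrow> ((nat \<Rightarrow> nat) \<Rightarrow>\<^sub>0 'k::field) \<Rightarrow> 'k"
  where "alternating_sum I q = (\<Sum>K\<in>Pow I. (- 1) ^ card K * Poly_Mapping.lookup q (swaps K))"

lemma swaps_insert:
  assumes "lacunar (insert x K)" "x \<notin> K"
  shows "swaps (insert x K) = swaps K \<circ> adj x"
proof
  fix z
  have nb: "Suc x \<notin> K" "\<And>y. y \<in> K \<Longrightarrow> Suc y \<noteq> x"
    using assms by (auto simp: lacunar_def)
  consider "z = x" | "z = Suc x" | "z \<noteq> x" "z \<noteq> Suc x" by blast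
  then show "swaps (insert x K) z = (swaps K \<circ> adj x) z"
  proof cases
    case 1
    then show ?thesis using nb assms(2) by (simp add: swaps_def)
  next
    case 2
    then show ?thesis using nb(1) nb(2)[of "x - 1"] assms(2) by (auto simp: swaps_def)
  next
    case 3
    then show ?thesis by (auto simp: swaps_def transpose_def)
  qed
qed

text \<open>
  Toggling \<open>x\<close> in \<open>K\<close> multiplies \<open>swaps K\<close> on the right by the transposition at \<open>x\<close>, which keeps the
  coefficient of \<open>q\<close> and flips the sign. The terms are cancelled in pairs, because in characteristic
  \<open>2\<close> a sum that equals its own negative need not vanish.
\<close>

lemma alternating_sum_eq_0:
  assumes "finite I" "lacunar I" "x \<in> I" and q: "translate (adj x) q = q"
  shows "alternating_sum I q = 0"
proof -
  define g where "g K = (- 1) ^ card K * Poly_Mapping.lookup q (swaps K)" for K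
  define P where "P = Pow (I - {x})"
  have neg: "g (insert x K) = - g K" if "K \<in> P" for K
  proof -
    have "finite K" "x \<notin> K" "lacunar (insert x K)"
      using that assms(1-3) finite_subset[of K I] by (auto simp: P_def lacunar_def)
    moreover have "Poly_Mapping.lookup q (swaps K \<circ> adj x) = Poly_Mapping.lookup q (swaps K)"
      using lookup_translate[of "adj x" q "swaps K"] q by simp
    ultimately show ?thesis by (simp add: g_def swaps_insert)
  qed
  have "Pow I = P \<union> insert x ` P"
    using Pow_insert[of x "I - {x}"] assms(3) by (simp add: P_def insert_absorb)
  moreover have "P \<inter> insert x ` P = {}" "finite P" using assms(1) by (auto simp: P_def)
  ultimately have "alternating_sum I q = sum g P + sum g (insert x ` P)"
    by (simp add: alternating_sum_def g_def[symmetric] sum.union_disjoint)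
  also have "inj_on (insert x) P" by (auto simp: P_def inj_on_def)
  then have "sum g (insert x ` P) = (\<Sum>K\<in>P. - g K)"
    using neg by (simp add: sum.reindex)
  finally show ?thesis by (simp add: sum_negf)
qed

text \<open>Otherwise every \<open>x \<in> I\<close> has \<open>x\<close> or \<open>x+1\<close> in \<open>J\<close>. Choosing one of them is injective since \<open>I\<close> is
  lacunar, and it does not lower the sum.\<close>

lemma lacunar_meets_gaps:
  assumes I: "I \<in> lacunar_sets n" and J: "J \<in> lacunar_sets n" and less: "\<Sum>J < \<Sum>I"
  shows "\<exists>x\<in>I. x \<in> gaps n J"
proof (rule ccontr)
  assume "\<not> ?thesis"
  then have cover: "x \<in> J \<or> Suc x \<in> J" if "x \<in> I" for x
  proof -
    have "x \<in> {1..n - 1}" using that I by (auto simp: lacunar_sets_def)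
    then show ?thesis using \<open>\<not> _\<close> that by (auto simp: gaps_def)
  qed
  define g where "g x = (if x \<in> J then x else Suc x)" for x
  have fin: "finite I" "finite J"
    using I J finite_subset by (auto simp: lacunar_sets_def)
  have "inj_on g I"
    using I by (auto simp: inj_on_def g_def lacunar_sets_def lacunar_def split: if_splits)
  then have "\<Sum>(g ` I) = (\<Sum>x\<in>I. g x)" by (simp add: sum.reindex)
  moreover have "\<Sum>I \<le> (\<Sum>x\<in>I. g x)" by (intro sum_mono) (simp add: g_def)
  moreover have "\<Sum>(g ` I) \<le> \<Sum>J"
    using fin cover by (intro sum_mono2) (auto simp: g_def)
  ultimately show False using less by simp
qed

lemma alternating_sum_lower:
  fixes q :: "(nat \<Rightarrow> nat) \<Rightarrow>\<^sub>0 'k::field"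
  assumes I: "I \<in> lacunar_sets n" and q: "q \<in> lower n I"
  shows "alternating_sum I q = 0"
proof -
  have fin: "finite I" using I finite_subset by (auto simp: lacunar_sets_def)
  have "ga.subspace {q :: (nat \<Rightarrow> nat) \<Rightarrow>\<^sub>0 'k. alternating_sum I q = 0}"
    by (rule ga.subspaceI)
      (simp_all add: alternating_sum_def lookup_add distrib_left sum.distrib mult.left_commute
        flip: sum_distrib_left)
  moreover have "(\<Union>J\<in>{J \<in> lacunar_sets n. \<Sum>J < \<Sum>I}. young_invariants n J) \<subseteq> {q :: (nat \<Rightarrow> nat) \<Rightarrow>\<^sub>0 'k. alternating_sum I q = 0}"
  proof clarify
    fix J and r :: "(nat \<Rightarrow> nat) \<Rightarrow>\<^sub>0 'k"
    assume "J \<in> lacunar_sets n" "\<Sum>J < \<Sum>I" and r: "r \<in> young_invariants n J"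
    then obtain x where "x \<in> I" "x \<in> gaps n J" using lacunar_meets_gaps[OF I] by blast
    then show "alternating_sum I r = 0"
      using r fin I by (intro alternating_sum_eq_0[of I x])
        (auto simp: young_invariants_def lacunar_sets_def)
  qed
  ultimately show ?thesis
    using q ga.span_minimal unfolding lower_def by blast
qed

text \<open>
  The witness is the sum of all permutations that fix \<open>I\<close> pointwise. Every nontrivial \<open>swaps K\<close> moves
  a point of \<open>I\<close>, so only \<open>K = {}\<close> contributes to the alternating sum.
\<close>

lemma young_invariants_not_lower:
  assumes I: "I \<in> lacunar_sets n"
  shows "\<not> (young_invariants n I :: ((nat \<Rightarrow> nat) \<Rightarrow>\<^sub>0 'k::field) set) \<subseteq> lower n I"
proof
  assume sub: "(young_invariants n I :: ((nat \<Rightarrow> nat) \<Rightarrow>\<^sub>0 'k) set) \<subseteq> lower n I"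
  define Y where "Y = {p. p permutes {1..n} \<and> (\<forall>x\<in>I. p x = x)}"
  define q :: "(nat \<Rightarrow> nat) \<Rightarrow>\<^sub>0 'k" where "q = (\<Sum>p\<in>Y. Poly_Mapping.single p 1)"
  have "finite Y"
    by (rule finite_subset[OF _ finite_permutations[of "{1..n}"]]) (auto simp: Y_def)
  then have lookup_q: "Poly_Mapping.lookup q g = (if g \<in> Y then 1 else 0)" for g
    by (simp add: q_def lookup_sum lookup_single when_def)
  have "q \<in> young_invariants n I"
    unfolding young_invariants_def
  proof (intro CollectI conjI ballI)
    show "q \<in> group_algebra (sym_group n)"
      by (auto simp: group_algebra_def sym_group_carrier in_keys_iff lookup_q Y_def split: if_splits)
    fix x assume x: "x \<in> gaps n I"
    have Y: "h \<circ> adj x \<in> Y" if "h \<in> Y" for h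
    proof -
      have "adj x permutes {1..n}" using x by (intro adj_permutes) (auto simp: gaps_def)
      then have "h \<circ> adj x permutes {1..n}" using that by (auto simp: Y_def intro: permutes_compose)
      moreover have "adj x y = y" if "y \<in> I" for y
        using that x by (auto simp: gaps_def transpose_def)
      ultimately show ?thesis using that by (simp add: Y_def)
    qed
    have "h \<circ> adj x \<in> Y \<longleftrightarrow> h \<in> Y" for h
      using Y[of h] Y[of "h \<circ> adj x"] by (auto simp: comp_assoc)
    then show "translate (adj x) q = q"
      by (intro poly_mapping_eqI) (simp add: lookup_translate lookup_q)
  qed
  then have "alternating_sum I q = 0" using sub alternating_sum_lower[OF I] by blast
  moreover have "swaps K \<in> Y \<longleftrightarrow> K = {}" if "K \<subseteq> I" for K
  proof
    assume K: "swaps K \<in> Y"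
    have "swaps K x = Suc x" if "x \<in> K" for x using that by (simp add: swaps_def)
    then show "K = {}" using K \<open>K \<subseteq> I\<close> by (fastforce simp: Y_def)
  next
    assume "K = {}"
    then have "swaps K = id" by (auto simp: swaps_def)
    then show "swaps K \<in> Y" by (simp add: Y_def permutes_id)
  qed
  then have "alternating_sum I q = (\<Sum>K\<in>Pow I. if K = {} then 1 else 0)"
    unfolding alternating_sum_def by (intro sum.cong) (auto simp: lookup_q)
  moreover have "finite (Pow I)" using I finite_subset by (auto simp: lacunar_sets_def)
  ultimately show False by simp
qed

section \<open>The spectrum\<close>

theorem corollary12p2:
  fixes n :: nat and lam :: "nat \<Rightarrow> 'k::field"
  shows "Spec ga_scale (group_algebra (sym_group n))
           (right_mult (sym_group n) (\<Sum>l\<in>{1..n}. ga_scale (lam l) (t_elem n l)))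
         = {\<Sum>l\<in>{1..n}. lam l * of_nat (m_num n I l) | I. I \<subseteq> {1..n - 1} \<and> lacunar I}"
proof -
  let ?T = "right_mult (sym_group n) (\<Sum>l\<in>{1..n}. ga_scale (lam l) (t_elem n l))"
  let ?c = "\<lambda>I. \<Sum>l\<in>{1..n}. lam l * of_nat (m_num n I l)"
  let ?F = "young_invariants n :: nat set \<Rightarrow> ((nat \<Rightarrow> nat) \<Rightarrow>\<^sub>0 'k) set"
  have "Spec ga_scale (group_algebra (sym_group n)) ?T = ?c ` lacunar_sets n"
  proof (rule ga.Spec_of_filtered_operator[where G = ?F and r = "\<lambda>I. \<Sum>I"])
    show "Vector_Spaces.linear ga_scale ga_scale ?T" by (rule right_mult_linear)
    show "finite (lacunar_sets n)"
      by (rule finite_subset[of _ "Pow {1..n - 1}"]) (auto simp: lacunar_sets_def)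
    \<comment> \<open>The full set has no gaps. Its lacunar refinement has none either, so its invariants are the
      whole algebra.\<close>
    obtain K where "K \<in> lacunar_sets n" "gaps n K \<subseteq> gaps n {1..n - 1}"
      by (rule lacunar_refinement[OF order_refl])
    moreover have "gaps n {1..n - 1} = {}" by (auto simp: gaps_def)
    ultimately have "group_algebra (sym_group n) \<subseteq> (\<Union>I\<in>lacunar_sets n. ?F I)"
      by (fastforce simp: young_invariants_def)
    moreover have "(\<Union>I\<in>lacunar_sets n. ?F I) \<subseteq> group_algebra (sym_group n)"
      by (auto simp: young_invariants_def)
    ultimately show "group_algebra (sym_group n) = ga.span (\<Union>I\<in>lacunar_sets n. ?F I)"
      by (metis ga.span_eq_iff subset_antisym subspace_group_algebra)
  next
    fix I and q :: "(nat \<Rightarrow> nat) \<Rightarrow>\<^sub>0 'k"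
    assume I: "I \<in> lacunar_sets n" and q: "q \<in> ?F I"
    have "?T q - ga_scale (?c I) q = (\<Sum>l\<in>{1..n}. ga_scale (lam l)
        ((\<Sum>j\<in>{l..n}. translate (cyc l j) q) - ga_scale (of_nat (m_num n I l)) q))"
      by (simp add: right_mult_sum right_mult_scale right_mult_t_elem ga.scale_sum_left
          ga.scale_right_diff_distrib sum_subtractf)
    also have "\<dots> \<in> lower n I"
      using I q by (intro ga.subspace_sum[OF subspace_lower] ga.subspace_scale[OF subspace_lower] t_elem_step) auto
    finally show "?T q - ga_scale (?c I) q \<in> ga.span (\<Union>J\<in>{J \<in> lacunar_sets n. \<Sum>J < \<Sum>I}. ?F J)"
      by (simp add: lower_def)
  next
    fix I assume "I \<in> lacunar_sets n"
    then show "\<not> ?F I \<subseteq> ga.span (\<Union>J\<in>{J \<in> lacunar_sets n. \<Sum>J < \<Sum>I}. ?F J)"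
      using young_invariants_not_lower unfolding lower_def by blast
  qed
  then show ?thesis by (auto simp: lacunar_sets_def)
qed

end
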